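(* Consider the two polynomials in $\mathbb{Z}[x_1,x_2,y_1,y_2,z]$ $$\begin{aligned} a' =\ & 144x_2^2z^9+144x_2y_1z^9+72x_1x_2z^8-384x_2^2z^8-240x_2y_1z^8-72x_2 y_2z^8-72z^{10}-192x_1x_2z^7\\ &+112x_2^2z^7-128x_2y_1z^7+120x_2y_2z^7+192 z^9+92x_1x_2z^6+384x_2^2z^6+256x_2y_1z^6+28x_2y_2z^6\\ &-92z^8+96x_1x_2z ^5-208x_2^2z^5+48x_2y_1z^5-24y_1^2z^5-68x_2y_2z^5-96z^7-40x_1x_2z^4\\ &- 64x_2^2z^4-16x_2y_1z^4-16y_1^2z^4-28x_2y_2z^4+12y_1y_2z^4+28z^6-32 x_1x_2z^3\\ &-48x_2^2z^3-64x_2y_1z^3+16y_1^2z^3+4x_2y_2z^3+8y_1y_2z^3+48 z^5-12x_1x_2z^2\\ &+64x_2^2z^2+16y_1^2z^2+16x_2y_2z^2-2y_1y_2z^2+18z^4+16x_1x_2z+8y_1^2z\\ &-4y_1y_2z-24z^3-2y_1y_2-2z^2+1, \\ b' =\ & -144x_1x_2z^9+144x_2y_2z^9-72x_1^2z^8+384x_1x_2z^8+72x_1y_2z^8-240x_2 y_2z^8+192x_1^2z^7\\ &- 112x_1x_2z^7-120x_1y_2z^7-128x_2y_2z^7-92x_1^2z^6 -384x_1x_2z^6-28x_1y_2z^6\\ &+256x_2y_2z^6-96x_1^2z^5+208x_1x_2z^5+68x_1 y_2z^5+48x_2y_2z^5-24y_1y_2z^5\\ &-24z^7+40x_1^2z^4+64x_1x_2z^4+28x_1y_2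 z^4-16x_2y_2z^4-16y_1y_2z^4\\ &+12y_2^2z^4+32z^6+32x_1^2z^3+48x_1x_2z^3- 4x_1y_2z^3-64x_2y_2z^3\\ &+16y_1y_2z^3+8y_2^2z^3+24z^5+12x_1^2z^2-64x_1 x_2z^2-16x_1y_2z^2\\ &+16y_1y_2z^2-2y_2^2z^2-32z^4-16x_1^2z+8y_1y_2z-4 y_2^2z-4z^3-2y_2^2+4z. \end{aligned}$$ The row $(a',b')$ is unimodular over $\mathbb{Z}[Q_4]$, and the morphism $Q_4\to Q_3$ over $\mathbb{Z}$ defined by this unimodular row has as complex realization the suspension of the Hopf map; that is, the induced continuous map $Q_4(\mathbb{C})\to Q_3(\mathbb{C})$ represents, under the homotopy equivalences $Q_4(\mathbb{C})\simeq S^4$ and $Q_3(\mathbb{C})\simeq S^3$, the class of the suspension of the Hopf map $S^3\to S^2$, i.e. the generator of $\pi_4(S^3)=\mathbb{Z}/2$.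
   Context: $Q_4=\operatorname{Spec}\mathbb{Z}[x_1,x_2,y_1,y_2,z]/(x_1y_1+x_2y_2-z(1-z))$, with coordinate ring $\mathbb{Z}[Q_4]$, and $Q_3=\operatorname{Spec}\mathbb{Z}[x_1,x_2,y_1,y_2]/(x_1y_1+x_2y_2-1)$. A row $(f_1,f_2)$ of elements of a ring $R$ is unimodular if there are $g_1,g_2\in R$ with $f_1g_1+f_2g_2=1$. A unimodular row $(f_1,f_2)$ over $\mathbb{Z}[Q_4]$ defines a morphism $Q_4\to Q_3$, $(x_1,x_2,y_1,y_2)\mapsto (f_1,f_2,g_1,g_2)$, for any choice of such $g_1,g_2$; two choices give morphisms that are homotopic via the linear homotopy $(1-s)g_i+sg_i'$, so the homotopy class does not depend on the choice. For $X=Q_4$ or $X=Q_3$, $X(\mathbb{C})$ carries the complex topology; the complex points of $Q_i$ are homotopy equivalent to the sphere $S^i$. The complex realization of a morphism $Q_4\to Q_3$ is the induced continuous map $Q_4(\mathbb{C})\to Q_3(\mathbb{C})$, viewed up to homotopy as an element of $\pi_4(S^3)$. *)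

theory Defs
  imports "HOL-Analysis.Analysis" "HOL-Library.Poly_Mapping"
begin

section \<open>The polynomial ring and the coordinate ring of the quadric\<close>

datatype qvar = X1 | X2 | Y1 | Y2 | Z

lemma UNIV_qvar: "UNIV = {X1, X2, Y1, Y2, Z}"
  using qvar.exhaust by blast

instance qvar :: finite
  by standard (simp add: UNIV_qvar)

text \<open>Monomials are finitely supported exponent vectors; the ring structure on
  \<^typ>\<open>(qvar \<Rightarrow>\<^sub>0 nat) \<Rightarrow>\<^sub>0 int\<close> is the convolution product, so this type is the polynomial ring
  over the integers in the five variables.\<close>

type_synonym zpoly = "(qvar \<Rightarrow>\<^sub>0 nat) \<Rightarrow>\<^sub>0 int"

definition Var :: "qvar \<Rightarrow> zpoly" where
  "Var v = Poly_Mapping.single (Poly_Mapping.single v 1) 1"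

definition eval_monom :: "(qvar \<Rightarrow> 'a::comm_ring_1) \<Rightarrow> (qvar \<Rightarrow>\<^sub>0 nat) \<Rightarrow> 'a" where
  "eval_monom s m = (\<Prod>v\<in>UNIV. s v ^ Poly_Mapping.lookup m v)"

definition eval_poly :: "(qvar \<Rightarrow> 'a::comm_ring_1) \<Rightarrow> zpoly \<Rightarrow> 'a" where
  "eval_poly s p = (\<Sum>m\<in>Poly_Mapping.keys p. of_int (Poly_Mapping.lookup p m) * eval_monom s m)"

lemma eval_monom_add: "eval_monom s (m + n) = eval_monom s m * eval_monom s n"
  by (simp add: eval_monom_def lookup_add power_add prod.distrib)

lemma eval_poly_superset:
  assumes "finite A" "Poly_Mapping.keys p \<subseteq> A"
  shows "eval_poly s p = (\<Sum>m\<in>A. of_int (Poly_Mapping.lookup p m) * eval_monom s m)"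
  unfolding eval_poly_def
  by (rule sum.mono_neutral_left) (use assms in \<open>auto simp: in_keys_iff\<close>)

lemma eval_poly_zero [simp]: "eval_poly s 0 = 0"
  by (simp add: eval_poly_def)

lemma eval_poly_add [simp]: "eval_poly s (p + q) = eval_poly s p + eval_poly s q"
proof -
  let ?A = "Poly_Mapping.keys p \<union> Poly_Mapping.keys q"
  have "eval_poly s (p + q)
      = (\<Sum>m\<in>?A. of_int (Poly_Mapping.lookup (p + q) m) * eval_monom s m)"
    by (rule eval_poly_superset) (auto simp: keys_add)
  moreover have "eval_poly s p = (\<Sum>m\<in>?A. of_int (Poly_Mapping.lookup p m) * eval_monom s m)"
    by (rule eval_poly_superset) auto
  moreover have "eval_poly s q = (\<Sum>m\<in>?A. of_int (Poly_Mapping.lookup q m) * eval_monom s m)"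
    by (rule eval_poly_superset) auto
  ultimately show ?thesis
    by (simp add: lookup_add algebra_simps sum.distrib)
qed

lemma eval_poly_single [simp]:
  "eval_poly s (Poly_Mapping.single m c) = of_int c * eval_monom s m"
  by (subst eval_poly_superset [of "{m}"]) (auto split: if_splits)

lemma eval_poly_uminus [simp]: "eval_poly s (- p) = - eval_poly s p"
  by (metis add.right_inverse eval_poly_add eval_poly_zero minus_unique)

lemma eval_poly_diff [simp]: "eval_poly s (p - q) = eval_poly s p - eval_poly s q"
  by (metis eval_poly_add eval_poly_uminus diff_conv_add_uminus)

lemma zpoly_induct [case_names zero add]:
  fixes p :: zpoly
  assumes "P 0" "\<And>m c p. P p \<Longrightarrow> P (Poly_Mapping.single m c + p)"
  shows "P p"
proof (induction p rule: update_induct)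
  case const
  show ?case by (fact assms(1))
next
  case (update p m c)
  have "Poly_Mapping.update m c p = Poly_Mapping.single m c + p"
    using update(1)
    by (intro poly_mapping_eqI) (auto simp: lookup_update lookup_add lookup_single in_keys_iff)
  then show ?case
    using assms(2) update(3) by simp
qed

lemma eval_poly_mult [simp]: "eval_poly s (p * q) = eval_poly s p * eval_poly s q"
proof (induction p rule: zpoly_induct)
  case (add m c p)
  have "eval_poly s (Poly_Mapping.single m c * q) = of_int c * eval_monom s m * eval_poly s q"
    by (induction q rule: zpoly_induct)
       (simp_all add: distrib_left mult_single eval_monom_add mult.assoc mult.left_commute)
  then show ?case
    using add by (simp add: distrib_right)
qed simp

lemma eval_poly_one [simp]: "eval_poly s 1 = 1"
proof -
  have "eval_poly s 1 = eval_poly s (Poly_Mapping.single 0 1)" by simp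
  also have "\<dots> = 1"
    by (simp only: eval_poly_single) (simp add: eval_monom_def)
  finally show ?thesis .
qed

lemma eval_poly_Var [simp]: "eval_poly s (Var v) = s v"
proof -
  have "(\<Prod>w\<in>UNIV. s w ^ (1 when v = w)) = (\<Prod>w\<in>UNIV. if w = v then s v else 1)"
    by (rule prod.cong) auto
  then show ?thesis
    by (simp add: Var_def eval_monom_def lookup_single)
qed

definition q4_relation :: zpoly where
  "q4_relation = Var X1 * Var Y1 + Var X2 * Var Y2 - Var Z * (1 - Var Z)"

definition q4_cong :: "zpoly \<Rightarrow> zpoly \<Rightarrow> bool" where
  "q4_cong p q \<longleftrightarrow> q4_relation dvd p - q"

lemma equivp_q4_cong: "equivp q4_cong"
proof (rule equivpI)
  show "reflp q4_cong"
    by (simp add: reflp_def q4_cong_def)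
  have "q4_relation dvd q - p" if "q4_relation dvd p - q" for p q
    using that by (subst dvd_minus_iff [symmetric]) simp
  then show "symp q4_cong"
    unfolding symp_def q4_cong_def by blast
  have "q4_relation dvd p - r" if "q4_relation dvd p - q" "q4_relation dvd q - r" for p q r
    using dvd_add [OF that] by simp
  then show "transp q4_cong"
    unfolding transp_def q4_cong_def by blast
qed

text \<open>The coordinate ring \<open>\<int>[Q\<^sub>4]\<close>, i.e. \<^typ>\<open>zpoly\<close> modulo the principal ideal generated by
  \<^const>\<open>q4_relation\<close>; its elements are the classes \<open>to_zq4 p\<close>.\<close>

quotient_type zq4 = zpoly / q4_cong
  by (rule equivp_q4_cong)

(* Otherwise lifting to zq4 would unfold zpoly to plain functions as well. *)
lifting_forget poly_mapping.lifting

lift_definition to_zq4 :: "zpoly \<Rightarrow> zq4" is "\<lambda>p. p" .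

instantiation zq4 :: comm_ring_1
begin

lift_definition zero_zq4 :: zq4 is 0 .
lift_definition one_zq4 :: zq4 is 1 .

lift_definition plus_zq4 :: "zq4 \<Rightarrow> zq4 \<Rightarrow> zq4" is "(+)"
proof -
  fix p p' q q' :: zpoly
  assume "q4_cong p p'" "q4_cong q q'"
  then have "q4_relation dvd (p - p') + (q - q')"
    unfolding q4_cong_def by (rule dvd_add)
  then show "q4_cong (p + q) (p' + q')"
    unfolding q4_cong_def by (simp add: algebra_simps)
qed

lift_definition uminus_zq4 :: "zq4 \<Rightarrow> zq4" is uminus
proof -
  fix p p' :: zpoly
  assume "q4_cong p p'"
  then have "q4_relation dvd - (p - p')"
    unfolding q4_cong_def by (simp only: dvd_minus_iff)
  then show "q4_cong (- p) (- p')"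
    unfolding q4_cong_def by simp
qed

lift_definition minus_zq4 :: "zq4 \<Rightarrow> zq4 \<Rightarrow> zq4" is "(-)"
proof -
  fix p p' q q' :: zpoly
  assume "q4_cong p p'" "q4_cong q q'"
  then have "q4_relation dvd (p - p') - (q - q')"
    unfolding q4_cong_def by (rule dvd_diff)
  then show "q4_cong (p - q) (p' - q')"
    unfolding q4_cong_def by (simp add: algebra_simps)
qed

lift_definition times_zq4 :: "zq4 \<Rightarrow> zq4 \<Rightarrow> zq4" is "(*)"
proof -
  fix p p' q q' :: zpoly
  assume "q4_cong p p'" "q4_cong q q'"
  then have "q4_relation dvd (p - p') * q + p' * (q - q')"
    unfolding q4_cong_def by (intro dvd_add dvd_mult dvd_mult2)
  then show "q4_cong (p * q) (p' * q')"
    unfolding q4_cong_def by (simp add: algebra_simps)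
qed

instance
proof
  show "(0::zq4) \<noteq> 1"
  proof
    assume "(0::zq4) = 1"
    then have "q4_cong 0 1"
      by transfer
    then obtain k where "- 1 = q4_relation * k"
      unfolding q4_cong_def by (auto simp: dvd_def)
    then have "eval_poly (\<lambda>_. 0::int) (- 1) = eval_poly (\<lambda>_. 0) (q4_relation * k)"
      by simp
    then show False
      by (simp add: q4_relation_def)
  qed
qed (transfer; simp add: q4_cong_def algebra_simps)+

end

lemma to_zq4_hom:
  "to_zq4 0 = 0" "to_zq4 1 = 1" "to_zq4 (p + q) = to_zq4 p + to_zq4 q"
  "to_zq4 (p - q) = to_zq4 p - to_zq4 q" "to_zq4 (p * q) = to_zq4 p * to_zq4 q"
  by (transfer, simp add: q4_cong_def)+

lemma to_zq4_eq_iff: "to_zq4 p = to_zq4 q \<longleftrightarrow> q4_relation dvd p - q"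
  by transfer (simp add: q4_cong_def)

definition unimodular_row :: "'a::comm_ring_1 \<Rightarrow> 'a \<Rightarrow> bool" where
  "unimodular_row f1 f2 \<longleftrightarrow> (\<exists>g1 g2. f1 * g1 + f2 * g2 = 1)"


section \<open>Points of the quadrics, morphisms and complex realization\<close>

text \<open>\<open>Q3_points\<close> and \<open>Q4_points\<close> are the functors of points of the two affine schemes. In particular
  a morphism \<open>Q\<^sub>4 \<rightarrow> Q\<^sub>3\<close> over the integers is the same as a \<^typ>\<open>zq4\<close>-valued point of \<open>Q\<^sub>3\<close>. The
  complex points carry the subspace topology from affine space.\<close>

definition Q3_points :: "('a::comm_ring_1 \<times> 'a \<times> 'a \<times> 'a) set" where
  "Q3_points = {(x1, x2, y1, y2). x1 * y1 + x2 * y2 = 1}"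

definition Q4_points :: "('a::comm_ring_1 \<times> 'a \<times> 'a \<times> 'a \<times> 'a) set" where
  "Q4_points = {(x1, x2, y1, y2, z). x1 * y1 + x2 * y2 = z * (1 - z)}"

fun coords :: "'a \<times> 'a \<times> 'a \<times> 'a \<times> 'a \<Rightarrow> qvar \<Rightarrow> 'a" where
  "coords (a, b, c, d, e) v = (case v of X1 \<Rightarrow> a | X2 \<Rightarrow> b | Y1 \<Rightarrow> c | Y2 \<Rightarrow> d | Z \<Rightarrow> e)"

lemma eval_poly_q4_relation: "P \<in> Q4_points \<Longrightarrow> eval_poly (coords P) q4_relation = 0"
  by (auto simp: Q4_points_def q4_relation_def)

text \<open>The value of a regular function at a complex point; off the quadric it is a dummy value.\<close>

lift_definition value_at ::
    "complex \<times> complex \<times> complex \<times> complex \<times> complex \<Rightarrow> zq4 \<Rightarrow> complex"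
  is "\<lambda>P f. if P \<in> Q4_points then eval_poly (coords P) f else 0"
proof -
  fix P :: "complex \<times> complex \<times> complex \<times> complex \<times> complex" and f g :: zpoly
  assume "q4_cong f g"
  then obtain k where "f = g + q4_relation * k"
    unfolding q4_cong_def dvd_def by (metis add.commute diff_add_cancel)
  then show "(if P \<in> Q4_points then eval_poly (coords P) f else 0)
      = (if P \<in> Q4_points then eval_poly (coords P) g else 0)"
    by (simp add: eval_poly_q4_relation)
qed

lemma value_at_to_zq4: "P \<in> Q4_points \<Longrightarrow> value_at P (to_zq4 f) = eval_poly (coords P) f"
  by transfer simp

fun realization :: "zq4 \<times> zq4 \<times> zq4 \<times> zq4
    \<Rightarrow> complex \<times> complex \<times> complex \<times> complex \<times> complex
    \<Rightarrow> complex \<times> complex \<times> complex \<times> complex" where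
  "realization (f1, f2, g1, g2) P = (value_at P f1, value_at P f2, value_at P g1, value_at P g2)"

lemma realization_in_Q3:
  assumes "F \<in> Q3_points" "P \<in> Q4_points"
  shows "realization F P \<in> Q3_points"
proof -
  have hom: "value_at P (f + g) = value_at P f + value_at P g"
      "value_at P (f * g) = value_at P f * value_at P g" "value_at P 1 = 1" for f g
    using assms(2) by (transfer; simp)+
  obtain f1 f2 g1 g2 where F: "F = (f1, f2, g1, g2)"
    by (metis surj_pair)
  have "f1 * g1 + f2 * g2 = 1"
    using assms(1) by (simp add: F Q3_points_def)
  then show ?thesis
    by (simp add: F Q3_points_def flip: hom)
qed

lemma continuous_on_realization: "continuous_on Q4_points (realization F)"
proof -
  have coords: "continuous_on S (\<lambda>P. coords P v)"
    for v and S :: "(complex \<times> complex \<times> complex \<times> complex \<times> complex) set"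
  proof -
    have "coords P v = (case v of X1 \<Rightarrow> fst P | X2 \<Rightarrow> fst (snd P) | Y1 \<Rightarrow> fst (snd (snd P))
        | Y2 \<Rightarrow> fst (snd (snd (snd P))) | Z \<Rightarrow> snd (snd (snd (snd P))))"
      for P :: "complex \<times> complex \<times> complex \<times> complex \<times> complex"
      by (cases P; cases v) auto
    then show ?thesis
      by (cases v) (simp_all add: continuous_on_fst continuous_on_snd)
  qed
  have value_at: "continuous_on Q4_points (\<lambda>P. value_at P f)" for f
  proof -
    have "\<exists>p. f = to_zq4 p"
      by transfer (intro exI, rule equivp_reflp [OF equivp_q4_cong])
    then obtain p where "f = to_zq4 p" ..
    moreover have "continuous_on Q4_points (\<lambda>P. eval_poly (coords P) p :: complex)"
      unfolding eval_poly_def eval_monom_def by (intro continuous_intros coords)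
    ultimately show ?thesis
      by (simp add: value_at_to_zq4 cong: continuous_on_cong)
  qed
  obtain f1 f2 g1 g2 where F: "F = (f1, f2, g1, g2)"
    by (metis surj_pair)
  have "realization F = (\<lambda>P. (value_at P f1, value_at P f2, value_at P g1, value_at P g2))"
    by (simp add: F fun_eq_iff)
  then show ?thesis
    by (simp add: continuous_on_Pair value_at)
qed


section \<open>The suspension of the Hopf map\<close>

text \<open>The spheres \<open>S\<^sup>2\<close>, \<open>S\<^sup>3\<close>, \<open>S\<^sup>4\<close> are the unit spheres of \<open>\<complex> \<times> \<real>\<close>, \<open>\<complex>\<^sup>2\<close> and \<open>\<complex>\<^sup>2 \<times> \<real>\<close>. As the target
  of the suspended map, \<open>S\<^sup>3\<close> is the unit sphere of \<open>(\<complex> \<times> \<real>) \<times> \<real>\<close>.\<close>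

definition hopf :: "complex \<times> complex \<Rightarrow> complex \<times> real" where
  "hopf = (\<lambda>(u, v). (2 * u * cnj v, (cmod u)\<^sup>2 - (cmod v)\<^sup>2))"

lemma hopf_in_sphere: "p \<in> sphere 0 1 \<Longrightarrow> hopf p \<in> sphere 0 1"
proof -
  assume p: "p \<in> sphere 0 1"
  obtain u v where uv: "p = (u, v)" by fastforce
  have 1: "(cmod u)\<^sup>2 + (cmod v)\<^sup>2 = 1"
    using p by (simp add: uv norm_Pair)
  have "(2 * cmod u * cmod v)\<^sup>2 + ((cmod u)\<^sup>2 - (cmod v)\<^sup>2)\<^sup>2 = ((cmod u)\<^sup>2 + (cmod v)\<^sup>2)\<^sup>2"
    by (simp add: power2_eq_square algebra_simps)
  then show ?thesis
    by (simp add: uv hopf_def norm_Pair norm_mult 1)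
qed

text \<open>The unit sphere of \<open>V \<times> \<real>\<close> is the unreduced suspension of the unit sphere of \<open>V\<close>: the point at
  height \<open>t\<close> over \<open>x\<close> is \<open>(sqrt (1 - t\<^sup>2) x, t)\<close>, and the suspension of a map acts on \<open>x\<close> and
  keeps \<open>t\<close>. At the two poles, where the first component vanishes, the formula below returns the
  pole of the same height because \<open>norm v = 0\<close> there.\<close>

definition suspension ::
    "('a::real_normed_vector \<Rightarrow> 'b::real_normed_vector) \<Rightarrow> 'a \<times> real \<Rightarrow> 'b \<times> real" where
  "suspension f = (\<lambda>(v, t). (norm v *\<^sub>R f (v /\<^sub>R norm v), t))"


section \<open>Comparison of the quadrics with spheres\<close>

definition homotopy_equivalence ::
    "'a::topological_space set \<Rightarrow> 'b::topological_space set \<Rightarrow> ('a \<Rightarrow> 'b) \<Rightarrow> bool" where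
  "homotopy_equivalence S T f \<longleftrightarrow>
     continuous_map (top_of_set S) (top_of_set T) f \<and>
     (\<exists>g. continuous_map (top_of_set T) (top_of_set S) g \<and>
          homotopic_with_canon (\<lambda>_. True) S S (g \<circ> f) id \<and>
          homotopic_with_canon (\<lambda>_. True) T T (f \<circ> g) id)"

text \<open>With \<open>x = u / 2\<close>, \<open>y = cnj u / 2\<close> and \<open>z = (1 + t) / 2\<close> the equation of \<open>Q\<^sub>4\<close> becomes
  \<open>|u\<^sub>1|\<^sup>2 + |u\<^sub>2|\<^sup>2 + t\<^sup>2 = 1\<close>, so this is the inclusion of a real form of the quadric.\<close>

definition sphere_to_Q4 ::
    "(complex \<times> complex) \<times> real \<Rightarrow> complex \<times> complex \<times> complex \<times> complex \<times> complex" where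
  "sphere_to_Q4 = (\<lambda>((u1, u2), t).
     (u1 / 2, u2 / 2, cnj u1 / 2, cnj u2 / 2, complex_of_real ((1 + t) / 2)))"

lemma sphere_to_Q4_in_Q4: "p \<in> sphere 0 1 \<Longrightarrow> sphere_to_Q4 p \<in> Q4_points"
proof -
  assume p: "p \<in> sphere 0 1"
  obtain u1 u2 t where p_eq: "p = ((u1, u2), t)" by (metis surj_pair)
  have "(cmod u1)\<^sup>2 + (cmod u2)\<^sup>2 + t\<^sup>2 = 1"
    using p by (simp add: p_eq norm_Pair)
  then have "(cmod u1)\<^sup>2 + (cmod u2)\<^sup>2 = 1 - t\<^sup>2"
    by simp
  then have "complex_of_real ((cmod u1)\<^sup>2 + (cmod u2)\<^sup>2) = complex_of_real (1 - t\<^sup>2)"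
    by (simp only:)
  then have "u1 * cnj u1 + u2 * cnj u2 = 1 - (complex_of_real t)\<^sup>2"
    by (simp only: of_real_add of_real_diff of_real_1 complex_norm_square of_real_power [of t])
  then have "(u1 * cnj u1 + u2 * cnj u2) / 4 = (1 - (complex_of_real t)\<^sup>2) / 4"
    by (simp only:)
  moreover have "(u1 * cnj u1 + u2 * cnj u2) / 4 = u1 / 2 * (cnj u1 / 2) + u2 / 2 * (cnj u2 / 2)"
    by (simp add: add_divide_distrib del: complex_mult_cnj)
  moreover have "(1 - (complex_of_real t)\<^sup>2) / 4
      = complex_of_real ((1 + t) / 2) * (1 - complex_of_real ((1 + t) / 2))"
    by (simp add: power2_eq_square field_simps)
  ultimately show ?thesis
    by (simp only: p_eq sphere_to_Q4_def Q4_points_def mem_Collect_eq prod.case)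
qed

text \<open>The homotopy equivalence \<open>(x, y) \<mapsto> x / norm x\<close> onto the unit sphere of \<open>\<complex>\<^sup>2\<close>, followed by
  the isometry \<open>(v, w) \<mapsto> ((v, Re w), Im w)\<close> from \<open>\<complex>\<^sup>2\<close> to \<open>(\<complex> \<times> \<real>) \<times> \<real>\<close>.\<close>

definition Q3_to_sphere ::
    "complex \<times> complex \<times> complex \<times> complex \<Rightarrow> (complex \<times> real) \<times> real" where
  "Q3_to_sphere = (\<lambda>(x1, x2, y1, y2).
     ((x1 /\<^sub>R norm (x1, x2), Re x2 / norm (x1, x2)), Im x2 / norm (x1, x2)))"

lemma Q3_to_sphere_in_sphere: "p \<in> Q3_points \<Longrightarrow> Q3_to_sphere p \<in> sphere 0 1"
proof -
  assume p: "p \<in> Q3_points"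
  obtain a b c d where p_eq: "p = (a, b, c, d)" by (metis surj_pair)
  have "(a, b) \<noteq> 0"
    using p by (auto simp: p_eq Q3_points_def zero_prod_def)
  then have n0: "norm (a, b) \<noteq> 0" by (simp only: norm_eq_zero not_False_eq_True)
  have n: "(norm (a, b))\<^sup>2 = (cmod a)\<^sup>2 + (Re b)\<^sup>2 + (Im b)\<^sup>2"
    by (simp add: norm_Pair cmod_power2)
  have "(cmod a / norm (a, b))\<^sup>2 + (Re b / norm (a, b))\<^sup>2 + (Im b / norm (a, b))\<^sup>2
      = (norm (a, b))\<^sup>2 / (norm (a, b))\<^sup>2"
    by (simp only: n power_divide add_divide_distrib)
  also have "\<dots> = 1"
    using n0 by simp
  finally have "(cmod a / norm (a, b))\<^sup>2 + (Re b / norm (a, b))\<^sup>2 + (Im b / norm (a, b))\<^sup>2 = 1" .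
  then show ?thesis
    by (simp add: p_eq Q3_to_sphere_def norm_Pair divide_inverse mult.commute)
qed


section \<open>The two polynomials\<close>

definition a' :: zpoly where
  "a' =
    (let x1 = Var X1; x2 = Var X2; y1 = Var Y1; y2 = Var Y2; z = Var Z in
     144*x2^2*z^9 + 144*x2*y1*z^9 + 72*x1*x2*z^8 - 384*x2^2*z^8 - 240*x2*y1*z^8
     - 72*x2*y2*z^8 - 72*z^10 - 192*x1*x2*z^7 + 112*x2^2*z^7 - 128*x2*y1*z^7
     + 120*x2*y2*z^7 + 192*z^9 + 92*x1*x2*z^6 + 384*x2^2*z^6 + 256*x2*y1*z^6
     + 28*x2*y2*z^6 - 92*z^8 + 96*x1*x2*z^5 - 208*x2^2*z^5 + 48*x2*y1*z^5 - 24*y1^2*z^5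
     - 68*x2*y2*z^5 - 96*z^7 - 40*x1*x2*z^4 - 64*x2^2*z^4 - 16*x2*y1*z^4 - 16*y1^2*z^4
     - 28*x2*y2*z^4 + 12*y1*y2*z^4 + 28*z^6 - 32*x1*x2*z^3 - 48*x2^2*z^3 - 64*x2*y1*z^3
     + 16*y1^2*z^3 + 4*x2*y2*z^3 + 8*y1*y2*z^3 + 48*z^5 - 12*x1*x2*z^2 + 64*x2^2*z^2
     + 16*y1^2*z^2 + 16*x2*y2*z^2 - 2*y1*y2*z^2 + 18*z^4 + 16*x1*x2*z + 8*y1^2*z
     - 4*y1*y2*z - 24*z^3 - 2*y1*y2 - 2*z^2 + 1)"

definition b' :: zpoly where
  "b' =
    (let x1 = Var X1; x2 = Var X2; y1 = Var Y1; y2 = Var Y2; z = Var Z in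
     -144*x1*x2*z^9 + 144*x2*y2*z^9 - 72*x1^2*z^8 + 384*x1*x2*z^8 + 72*x1*y2*z^8
     - 240*x2*y2*z^8 + 192*x1^2*z^7 - 112*x1*x2*z^7 - 120*x1*y2*z^7 - 128*x2*y2*z^7
     - 92*x1^2*z^6 - 384*x1*x2*z^6 - 28*x1*y2*z^6 + 256*x2*y2*z^6 - 96*x1^2*z^5
     + 208*x1*x2*z^5 + 68*x1*y2*z^5 + 48*x2*y2*z^5 - 24*y1*y2*z^5 - 24*z^7 + 40*x1^2*z^4
     + 64*x1*x2*z^4 + 28*x1*y2*z^4 - 16*x2*y2*z^4 - 16*y1*y2*z^4 + 12*y2^2*z^4 + 32*z^6
     + 32*x1^2*z^3 + 48*x1*x2*z^3 - 4*x1*y2*z^3 - 64*x2*y2*z^3 + 16*y1*y2*z^3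
     + 8*y2^2*z^3 + 24*z^5 + 12*x1^2*z^2 - 64*x1*x2*z^2 - 16*x1*y2*z^2 + 16*y1*y2*z^2
     - 2*y2^2*z^2 - 32*z^4 - 16*x1^2*z + 8*y1*y2*z - 4*y2^2*z - 4*z^3 - 2*y2^2 + 4*z)"

end

theory Submission
  imports Defs
begin

text \<open>Let \<open>M = [[x2, -x1], [y1, y2]]\<close>, so that \<open>det M = z (1 - z)\<close> on \<open>Q\<^sub>4\<close>. There is a matrix
  \<open>E(z) = e22 I + z (1 - z) N\<close> in \<open>SL\<^sub>2(\<int>[z])\<close> with \<open>N = [[n11, n12], [n21, 0]]\<close>, \<open>E(0) = I\<close> and
  \<open>E(1) = -I\<close>. Its conjugate \<open>W = M\<^sup>-\<^sup>1 E M = e22 I + adj(M) N M\<close> is defined over \<open>\<int>[Q\<^sub>4]\<close>, has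
  determinant 1, and \<open>(a', b') = (f1, f2) W\<close> for a unimodular row \<open>(f1, f2)\<close> over \<open>\<int>[z]\<close>.

  On \<open>S\<^sup>4\<close>, away from the poles, \<open>M\<close> is a multiple of a matrix \<open>U\<close> in \<open>SU(2)\<close>, so \<open>W = U\<^sup>-\<^sup>1 E U\<close>
  where \<open>E\<close> is a path in \<open>SL\<^sub>2(\<real>)\<close> from \<open>I\<close> to \<open>-I\<close>. The segment from \<open>E\<close> to
  \<open>D = diag(-t - i n, -t + i n)\<close>, \<open>n = sqrt (1 - t\<^sup>2)\<close>, consists of invertible matrices because
  \<open>E\<^sub>1\<^sub>1 > E\<^sub>2\<^sub>2\<close> between the poles, and it is constant at the poles, so conjugating it by \<open>U\<close> gives a
  homotopy on all of \<open>S\<^sup>4\<close>. The first row of \<open>U\<^sup>-\<^sup>1 D U\<close> is the suspended Hopf map up to a unitary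
  change of coordinates, and \<open>(f1, f2)\<close> contracts to its value \<open>(1, 0)\<close> at \<open>z = 0\<close>.\<close>


section \<open>Factorization of the row\<close>

definition n11 :: "'a::comm_ring_1 \<Rightarrow> 'a" where
  "n11 z = 16*z^2 + 4*z^3 + 4*z^4 - 60*z^5 + 36*z^6"
definition n12 :: "'a::comm_ring_1 \<Rightarrow> 'a" where
  "n12 z = - 2 - 4*z - 6*z^2"
definition n21 :: "'a::comm_ring_1 \<Rightarrow> 'a" where
  "n21 z = 16*z - 12*z^2 - 64*z^4 + 96*z^5 - 36*z^6"
definition e22 :: "'a::comm_ring_1 \<Rightarrow> 'a" where
  "e22 z = 1 - 24*z^3 + 18*z^4 + 64*z^6 - 96*z^7 + 36*z^8"
definition f1 :: "'a::comm_ring_1 \<Rightarrow> 'a" where "f1 z = 1 - 2*z^2"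
definition f2 :: "'a::comm_ring_1 \<Rightarrow> 'a" where "f2 z = 4*z - 4*z^3"

text \<open>The entries of \<open>W = e22 I + adj(M) N M\<close>. Writing \<open>adj(M)\<close> in
  place of \<open>M^-1\<close> makes them polynomial, so they can be evaluated at points with values
  in any commutative ring.\<close>

fun w11 :: "'a \<times> 'a \<times> 'a \<times> 'a \<times> 'a \<Rightarrow> 'a::comm_ring_1" where
  "w11 (x1, x2, y1, y2, z) = e22 z + y2 * (n11 z * x2 + n12 z * y1) + x1 * (n21 z * x2)"
fun w12 :: "'a \<times> 'a \<times> 'a \<times> 'a \<times> 'a \<Rightarrow> 'a::comm_ring_1" where
  "w12 (x1, x2, y1, y2, z) = y2 * (n12 z * y2 - n11 z * x1) - x1 * (n21 z * x1)"
fun w21 :: "'a \<times> 'a \<times> 'a \<times> 'a \<times> 'a \<Rightarrow> 'a::comm_ring_1" where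
  "w21 (x1, x2, y1, y2, z) = x2 * (n21 z * x2) - y1 * (n11 z * x2 + n12 z * y1)"
fun w22 :: "'a \<times> 'a \<times> 'a \<times> 'a \<times> 'a \<Rightarrow> 'a::comm_ring_1" where
  "w22 (x1, x2, y1, y2, z) = e22 z - y1 * (n12 z * y2 - n11 z * x1) - x2 * (n21 z * x1)"

lemma f_unimodular: "f1 z * f1 z + f2 z * z = 1"
  by (simp add: f1_def f2_def algebra_simps eval_nat_numeral)

lemma det_path: "e22 z * (e22 z + z * (1 - z) * n11 z) - (z * (1 - z))^2 * (n12 z * n21 z) = 1"
  by (simp add: n11_def n12_def n21_def e22_def algebra_simps eval_nat_numeral)

text \<open>Use \<open>det (c I + A) = c^2 + c tr A + det A\<close> for
  \<open>A = adj(M) N M\<close> with \<open>N = [[n, k], [l, 0]]\<close>. Since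
  \<open>M adj(M) = w I\<close>, one has \<open>tr A = w n\<close> and
  \<open>det A = w^2 det N = - w^2 k l\<close>.\<close>

lemma det_w_aux:
  fixes x1 :: "'a::comm_ring_1"
  assumes "x1 * y1 + x2 * y2 = w"
  shows "(c + y2 * (n * x2 + k * y1) + x1 * (l * x2)) * (c - y1 * (k * y2 - n * x1) - x2 * (l * x1))
      - (y2 * (k * y2 - n * x1) - x1 * (l * x1)) * (x2 * (l * x2) - y1 * (n * x2 + k * y1))
    = c * (c + w * n) - w^2 * (k * l)"
  unfolding assms [symmetric] by (simp add: algebra_simps power2_eq_square)

lemma det_w: "P \<in> Q4_points \<Longrightarrow> w11 P * w22 P - w12 P * w21 P = 1"
  by (cases P) (simp add: Q4_points_def det_w_aux det_path)

lemma eval_poly_of_nat [simp]: "eval_poly s (of_nat n) = of_nat n"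
  by (induction n) simp_all

lemma eval_poly_numeral [simp]: "eval_poly s (numeral k) = numeral k"
  by (metis eval_poly_of_nat of_nat_numeral)

lemma eval_poly_power [simp]: "eval_poly s (p ^ n) = eval_poly s p ^ n"
  by (induction n) simp_all

lemma eval_a':
  "eval_poly (coords (x1, x2, y1, y2, z)) a'
    = f1 z * w11 (x1, x2, y1, y2, z) + f2 z * w21 (x1, x2, y1, y2, z)"
  by (simp add: a'_def Let_def f1_def f2_def n11_def n12_def n21_def e22_def algebra_simps
    eval_nat_numeral)

lemma eval_b':
  assumes "(x1, x2, y1, y2, z) \<in> Q4_points"
  shows "eval_poly (coords (x1, x2, y1, y2, z)) b'
    = f1 z * w12 (x1, x2, y1, y2, z) + f2 z * w22 (x1, x2, y1, y2, z)"
proof -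
  \<comment> \<open>In \<open>b'\<close> the product \<open>x1 * y1\<close>, which occurs in
    \<open>w22\<close>, has been eliminated by the equation of the quadric; this causes the last
    term. The entries \<open>w11\<close> and \<open>w21\<close> behind \<open>a'\<close> contain no
    such product.\<close>
  have "eval_poly (coords (x1, x2, y1, y2, z)) b'
      = f1 z * w12 (x1, x2, y1, y2, z) + f2 z * w22 (x1, x2, y1, y2, z)
        - f2 z * n11 z * (x1 * y1 + x2 * y2 - z * (1 - z))"
    by (simp add: b'_def Let_def f1_def f2_def n11_def n12_def n21_def e22_def algebra_simps
      eval_nat_numeral)
  then show ?thesis using assms by (simp add: Q4_points_def)
qed

section \<open>Unimodularity over the coordinate ring\<close>

lemma to_zq4_of_nat: "to_zq4 (of_nat n) = of_nat n"
  by (induction n) (simp_all add: to_zq4_hom)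

lemma to_zq4_numeral: "to_zq4 (numeral k) = numeral k"
  by (metis to_zq4_of_nat of_nat_numeral)

lemma to_zq4_power: "to_zq4 (p ^ n) = to_zq4 p ^ n"
  by (induction n) (simp_all add: to_zq4_hom)

lemma to_zq4_uminus: "to_zq4 (- p) = - to_zq4 p"
  by (metis to_zq4_hom(1,4) diff_0)

lemmas to_zq4_simps = to_zq4_hom to_zq4_numeral to_zq4_power to_zq4_uminus

text \<open>The tautological point of the quadric over its own coordinate ring. Evaluating a
  polynomial there gives its class, so identities proved for all points become identities between
  classes.\<close>

abbreviation generic_point :: "zq4 \<times> zq4 \<times> zq4 \<times> zq4 \<times> zq4" where
  "generic_point \<equiv>
    (to_zq4 (Var X1), to_zq4 (Var X2), to_zq4 (Var Y1), to_zq4 (Var Y2), to_zq4 (Var Z))"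

lemma generic_point_in_Q4: "generic_point \<in> Q4_points"
proof -
  have "to_zq4 q4_relation = 0"
    by (simp add: to_zq4_eq_iff flip: to_zq4_hom(1))
  then show ?thesis
    by (simp add: Q4_points_def q4_relation_def to_zq4_hom)
qed

lemma to_zq4_a': "to_zq4 a' = eval_poly (coords generic_point) a'"
  by (simp add: a'_def Let_def to_zq4_simps)

lemma to_zq4_b': "to_zq4 b' = eval_poly (coords generic_point) b'"
  by (simp add: b'_def Let_def to_zq4_simps)

lemma unimodular_row_mult_det_1:
  fixes a b c d :: "'a::comm_ring_1"
  assumes "u * g + v * h = 1" "a * d - b * c = 1"
  shows "unimodular_row (u * a + v * c) (u * b + v * d)"
proof -
  \<comment> \<open>The witnesses are the adjugate of \<open>[[a, b], [c, d]]\<close> applied to the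
    column \<open>(g, h)\<close>.\<close>
  have "(u * a + v * c) * (d * g - b * h) + (u * b + v * d) * (a * h - c * g)
      = (u * g + v * h) * (a * d - b * c)"
    by (simp add: algebra_simps)
  with assms show ?thesis
    unfolding unimodular_row_def by (metis mult_1)
qed

lemma unimodular_a'_b': "unimodular_row (to_zq4 a') (to_zq4 b')"
  unfolding to_zq4_a' to_zq4_b' eval_a' eval_b' [OF generic_point_in_Q4]
  by (intro unimodular_row_mult_det_1 [OF f_unimodular] det_w generic_point_in_Q4)


section \<open>The quadrics as spheres\<close>

lemma homotopic_with_canonI:
  fixes h :: "real \<times> 'a::topological_space \<Rightarrow> 'b::topological_space"
  assumes "continuous_on ({0..1} \<times> S) h"
    and "\<And>s x. s \<in> {0..1} \<Longrightarrow> x \<in> S \<Longrightarrow> h (s, x) \<in> T"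
    and "\<And>x. x \<in> S \<Longrightarrow> h (0, x) = p x" "\<And>x. x \<in> S \<Longrightarrow> h (1, x) = q x"
  shows "homotopic_with_canon (\<lambda>_. True) S T p q"
proof -
  have "continuous_map (prod_topology (top_of_set {0..1}) (top_of_set S)) (top_of_set T) h"
    using assms(1,2) by (auto simp: prod_topology_subtopology_eu)
  with assms(3,4) show ?thesis
    by (subst homotopic_with) auto
qed

section \<open>Retraction of the three-dimensional quadric onto its sphere\<close>

definition sphere_to_Q3 ::
    "(complex \<times> real) \<times> real \<Rightarrow> complex \<times> complex \<times> complex \<times> complex" where
  "sphere_to_Q3 = (\<lambda>((v, r), i). (v, Complex r i, cnj v, Complex r (- i)))"

lemma Q3_points_nonzero: "(a, b, c, d) \<in> Q3_points \<Longrightarrow> norm (a, b) > 0"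
  for a :: complex
  by (auto simp: Q3_points_def zero_prod_def)

lemma norm_Pair_complex: "complex_of_real ((norm (a, b))\<^sup>2) = a * cnj a + b * cnj b"
  for a b :: complex
  by (simp add: norm_Pair complex_norm_square del: complex_mult_cnj of_real_power)

lemma sphere_to_Q3_in_Q3:
  assumes "p \<in> sphere 0 1"
  shows "sphere_to_Q3 p \<in> Q3_points"
proof -
  obtain v r i where p: "p = ((v, r), i)" by (metis surj_pair)
  have "(cmod v)\<^sup>2 + r\<^sup>2 + i\<^sup>2 = 1"
    using assms by (simp add: p norm_Pair)
  then have "(norm (v, Complex r i))\<^sup>2 = 1"
    by (simp add: norm_Pair cmod_power2)
  then have "v * cnj v + Complex r i * cnj (Complex r i) = 1"
    by (simp only: norm_Pair_complex [symmetric] of_real_1)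
  then show ?thesis
    by (simp add: p sphere_to_Q3_def Q3_points_def complex_cnj)
qed

lemma Q3_to_sphere_sphere_to_Q3: "Q3_to_sphere (sphere_to_Q3 p) = p" if "p \<in> sphere 0 1"
proof -
  obtain v r i where p: "p = ((v, r), i)" by (metis surj_pair)
  have "(cmod v)\<^sup>2 + r\<^sup>2 + i\<^sup>2 = 1"
    using that by (simp add: p norm_Pair)
  then have "norm (v, Complex r i) = 1"
    by (simp add: norm_Pair cmod_power2)
  then show ?thesis
    by (simp add: p sphere_to_Q3_def Q3_to_sphere_def)
qed

lemma continuous_on_Q3_to_sphere: "continuous_on Q3_points Q3_to_sphere"
  unfolding Q3_to_sphere_def case_prod_unfold
  by (intro continuous_intros) (use Q3_points_nonzero in \<open>fastforce\<close>)+

lemma continuous_on_sphere_to_Q3: "continuous_on S sphere_to_Q3"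
  unfolding sphere_to_Q3_def case_prod_unfold Complex_eq by (intro continuous_intros)

text \<open>The row \<open>x\<close> is rescaled from length \<open>N\<close> to length 1. For fixed
  \<open>x\<close> the equation is affine in \<open>y\<close>, so \<open>y\<close> can move along
  the segment to the solution \<open>cnj x / N^2\<close>; dividing by \<open>l\<close> compensates
  the rescaling of \<open>x\<close>.\<close>

definition Q3_deformation ::
    "real \<times> complex \<times> complex \<times> complex \<times> complex \<Rightarrow> complex \<times> complex \<times> complex \<times> complex" where
  "Q3_deformation = (\<lambda>(s, x1, x2, y1, y2).
     let N = norm (x1, x2); l = complex_of_real (1 - s + s / N) in
     (l * x1, l * x2, (of_real (1 - s) * y1 + of_real (s / N\<^sup>2) * cnj x1) / l,
       (of_real (1 - s) * y2 + of_real (s / N\<^sup>2) * cnj x2) / l))"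

lemma deformation_factor_pos:
  assumes "N > 0" "s \<in> {0..1}"
  shows "1 - s + s / N > (0::real)"
proof (cases "s = 1")
  case False
  then show ?thesis using assms by (intro add_pos_nonneg) auto
qed (use assms in auto)

lemma homotopy_equivalence_Q3: "homotopy_equivalence Q3_points (sphere 0 1) Q3_to_sphere"
  unfolding homotopy_equivalence_def
proof (intro conjI exI)
  show "continuous_map (top_of_set Q3_points) (top_of_set (sphere 0 1)) Q3_to_sphere"
    using continuous_on_Q3_to_sphere Q3_to_sphere_in_sphere
    by (auto)
  show "continuous_map (top_of_set (sphere 0 1)) (top_of_set Q3_points) sphere_to_Q3"
    using continuous_on_sphere_to_Q3 sphere_to_Q3_in_Q3
    by (auto)
  show "homotopic_with_canon (\<lambda>_. True) (sphere 0 1) (sphere 0 1) (Q3_to_sphere \<circ> sphere_to_Q3) id"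
    using Q3_to_sphere_sphere_to_Q3 by (intro homotopic_with_id2) simp
  have factor: "complex_of_real (1 - s + s / norm (x1, x2)) \<noteq> 0"
    if "(x1, x2, y1, y2) \<in> Q3_points" "s \<in> {0..1}" for s and x1 x2 y1 y2 :: complex
    using deformation_factor_pos [OF Q3_points_nonzero, OF that] by (metis less_irrefl of_real_eq_0_iff)
  have "homotopic_with_canon (\<lambda>_. True) Q3_points Q3_points id (sphere_to_Q3 \<circ> Q3_to_sphere)"
  proof (rule homotopic_with_canonI)
    show "continuous_on ({0..1} \<times> Q3_points) Q3_deformation"
      unfolding Q3_deformation_def case_prod_unfold Let_def
      by (intro continuous_intros; use factor Q3_points_nonzero in fastforce)
    fix P :: "complex \<times> complex \<times> complex \<times> complex"
    assume P: "P \<in> Q3_points"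
    obtain x1 x2 y1 y2 where P_eq: "P = (x1, x2, y1, y2)" by (metis surj_pair)
    define N where "N = norm (x1, x2)"
    have N: "N > 0"
      using P Q3_points_nonzero by (simp add: P_eq N_def)
    have xy: "x1 * y1 + x2 * y2 = 1"
      using P by (simp add: P_eq Q3_points_def)
    have xx: "x1 * cnj x1 + x2 * cnj x2 = (of_real N)\<^sup>2"
      by (simp only: N_def norm_Pair_complex [symmetric] of_real_power)
    show "Q3_deformation (0, P) = id P"
      by (simp add: P_eq Q3_deformation_def)
    show "Q3_deformation (1, P) = (sphere_to_Q3 \<circ> Q3_to_sphere) P"
      using N by (simp add: P_eq Q3_deformation_def sphere_to_Q3_def Q3_to_sphere_def Let_def
        complex_eq_iff power2_eq_square zero_prod_def flip: N_def) (simp add: field_simps)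
    fix s :: real
    assume s: "s \<in> {0..1}"
    have "1 - s + s / N \<noteq> 0"
      using deformation_factor_pos [OF N s] by simp
    then have l: "complex_of_real (1 - s + s / N) \<noteq> 0"
      by (simp only: of_real_eq_0_iff not_False_eq_True)
    \<comment> \<open>The factor \<open>l\<close> cancels, and for the coefficients inserted below
      the right-hand side is \<open>(1 - s) * 1 + (s / N^2) * N^2 = 1\<close>.\<close>
    have "l * x1 * ((a * y1 + b * cnj x1) / l) + l * x2 * ((a * y2 + b * cnj x2) / l)
        = a * (x1 * y1 + x2 * y2) + b * (x1 * cnj x1 + x2 * cnj x2)" if "l \<noteq> 0" for a b l
      using that by (simp add: field_simps del: complex_mult_cnj)
    from this [OF l, of "of_real (1 - s)" "of_real (s / N\<^sup>2)"]
    show "Q3_deformation (s, P) \<in> Q3_points"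
      using N by (simp add: P_eq Q3_deformation_def Q3_points_def Let_def xy xx flip: N_def)
  qed
  then show "homotopic_with_canon (\<lambda>_. True) Q3_points Q3_points (sphere_to_Q3 \<circ> Q3_to_sphere) id"
    by (rule homotopic_with_symD)
qed

section \<open>Retraction of the four-dimensional quadric onto its sphere\<close>

text \<open>Real and imaginary parts of the linear coordinates in which \<open>Q\<^sub>4\<close> is the affine sphere
  \<open>\<zeta>\<^sub>1\<^sup>2 + \<dots> + \<zeta>\<^sub>5\<^sup>2 = 1\<close>.\<close>

fun Q4_Re :: "complex \<times> complex \<times> complex \<times> complex \<times> complex \<Rightarrow> (complex \<times> complex) \<times> real" where
  "Q4_Re (x1, x2, y1, y2, z) = ((x1 + cnj y1, x2 + cnj y2), 2 * Re z - 1)"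

fun Q4_Im :: "complex \<times> complex \<times> complex \<times> complex \<times> complex \<Rightarrow> (complex \<times> complex) \<times> real" where
  "Q4_Im (x1, x2, y1, y2, z) = ((- \<i> * (x1 - cnj y1), - \<i> * (x2 - cnj y2)), 2 * Im z)"

fun Q4_Complex :: "(complex \<times> complex) \<times> real \<Rightarrow> (complex \<times> complex) \<times> real
    \<Rightarrow> complex \<times> complex \<times> complex \<times> complex \<times> complex" where
  "Q4_Complex ((u1, u2), t) ((v1, v2), r) =
    ((u1 + \<i> * v1) / 2, (u2 + \<i> * v2) / 2, (cnj u1 + \<i> * cnj v1) / 2, (cnj u2 + \<i> * cnj v2) / 2,
     Complex ((1 + t) / 2) (r / 2))"

lemma Q4_Complex_Re_Im: "Q4_Complex (Q4_Re P) (Q4_Im P) = P"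
  by (cases P) (simp add: complex_eq_iff)

lemma sphere_to_Q4_eq: "sphere_to_Q4 p = Q4_Complex p 0"
  by (cases p; cases "fst p") (simp add: sphere_to_Q4_def zero_prod_def complex_eq_iff)

lemma Q4_Re_sphere_to_Q4: "Q4_Re (sphere_to_Q4 p) = p"
  by (cases p; cases "fst p") (simp add: sphere_to_Q4_def complex_eq_iff field_simps)

text \<open>The two conditions are the real and imaginary parts of the equation that the squares of
  the coordinates of \<open>p + i q\<close> sum to 1.\<close>

lemma Q4_Complex_in_Q4_iff:
  "Q4_Complex p q \<in> Q4_points \<longleftrightarrow> (norm p)\<^sup>2 = 1 + (norm q)\<^sup>2 \<and> inner p q = 0"
proof -
  obtain u1 u2 t where p: "p = ((u1, u2), t)" by (metis surj_pair)
  obtain v1 v2 r where q: "q = ((v1, v2), r)" by (metis surj_pair)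
  show ?thesis
    unfolding power2_norm_eq_inner
    by (simp add: p q Q4_points_def complex_eq_iff inner_complex_def inner_prod_def field_simps) argo
qed

lemma Q4_norm:
  assumes "P \<in> Q4_points"
  shows "(norm (Q4_Re P))\<^sup>2 = 1 + (norm (Q4_Im P))\<^sup>2" "inner (Q4_Re P) (Q4_Im P) = 0"
  using assms Q4_Complex_in_Q4_iff [of "Q4_Re P" "Q4_Im P"] by (simp_all add: Q4_Complex_Re_Im)

lemma Q4_Re_nonzero: "P \<in> Q4_points \<Longrightarrow> Q4_Re P \<noteq> 0"
  using Q4_norm(1) [of P] by (auto simp: add_nonneg_eq_0_iff)

lemma continuous_on_Q4_Re [continuous_intros]:
  "continuous_on S f \<Longrightarrow> continuous_on S (\<lambda>x. Q4_Re (f x))"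
proof -
  have "Q4_Re P = (case P of (x1, x2, y1, y2, z) \<Rightarrow> ((x1 + cnj y1, x2 + cnj y2), 2 * Re z - 1))" for P
    by (cases P) simp
  then show "continuous_on S f \<Longrightarrow> continuous_on S (\<lambda>x. Q4_Re (f x))"
    by (simp only: case_prod_unfold) (intro continuous_intros)
qed

lemma continuous_on_Q4_Im [continuous_intros]:
  "continuous_on S f \<Longrightarrow> continuous_on S (\<lambda>x. Q4_Im (f x))"
proof -
  have "Q4_Im P = (case P of (x1, x2, y1, y2, z) \<Rightarrow> ((- \<i> * (x1 - cnj y1), - \<i> * (x2 - cnj y2)), 2 * Im z))" for P
    by (cases P) simp
  then show "continuous_on S f \<Longrightarrow> continuous_on S (\<lambda>x. Q4_Im (f x))"
    by (simp only: case_prod_unfold) (intro continuous_intros)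
qed

lemma continuous_on_Q4_Complex [continuous_intros]:
  "continuous_on S f \<Longrightarrow> continuous_on S g \<Longrightarrow> continuous_on S (\<lambda>x. Q4_Complex (f x) (g x))"
proof -
  have "Q4_Complex p q = (case (p, q) of (((u1, u2), t), ((v1, v2), r)) \<Rightarrow>
    ((u1 + \<i> * v1) / 2, (u2 + \<i> * v2) / 2, (cnj u1 + \<i> * cnj v1) / 2, (cnj u2 + \<i> * cnj v2) / 2,
     complex_of_real ((1 + t) / 2) + \<i> * complex_of_real (r / 2)))" for p q
    by (auto simp: Complex_eq split: prod.split)
  then show "continuous_on S f \<Longrightarrow> continuous_on S g \<Longrightarrow> continuous_on S (\<lambda>x. Q4_Complex (f x) (g x))"
    by (simp only: case_prod_unfold fst_conv snd_conv) (intro continuous_intros; simp)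
qed

lemma homotopy_equivalence_Q4: "homotopy_equivalence (sphere 0 1) Q4_points sphere_to_Q4"
  unfolding homotopy_equivalence_def
proof (intro conjI exI)
  show "continuous_map (top_of_set (sphere 0 1)) (top_of_set Q4_points) sphere_to_Q4"
    using sphere_to_Q4_in_Q4 by (auto simp: sphere_to_Q4_eq [abs_def] intro!: continuous_intros)
  show "continuous_map (top_of_set Q4_points) (top_of_set (sphere 0 1)) (\<lambda>P. sgn (Q4_Re P))"
    using Q4_Re_nonzero by (auto simp: norm_sgn intro!: continuous_intros)
  show "homotopic_with_canon (\<lambda>_. True) (sphere 0 1) (sphere 0 1)
      ((\<lambda>P. sgn (Q4_Re P)) \<circ> sphere_to_Q4) id"
    by (intro homotopic_with_id2) (simp add: Q4_Re_sphere_to_Q4 sgn_div_norm)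
  \<comment> \<open>The imaginary part shrinks linearly while the real part keeps its direction;
    \<open>?c\<close> is the length that the real part must have for the point to stay on the
    quadric.\<close>
  let ?c = "\<lambda>s P. sqrt (1 + s\<^sup>2 * (norm (Q4_Im P))\<^sup>2)"
  define h where "h = (\<lambda>(s, P). Q4_Complex (?c s P *\<^sub>R sgn (Q4_Re P)) (s *\<^sub>R Q4_Im P))"
  show "homotopic_with_canon (\<lambda>_. True) Q4_points Q4_points
      (sphere_to_Q4 \<circ> (\<lambda>P. sgn (Q4_Re P))) id"
  proof (rule homotopic_with_canonI)
    show "continuous_on ({0..1} \<times> Q4_points) h"
      unfolding h_def case_prod_unfold
      using Q4_Re_nonzero by (auto intro!: continuous_intros)
    fix P :: "complex \<times> complex \<times> complex \<times> complex \<times> complex"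
    assume P: "P \<in> Q4_points"
    show "h (0, P) = (sphere_to_Q4 \<circ> (\<lambda>P. sgn (Q4_Re P))) P"
      by (simp add: h_def sphere_to_Q4_eq)
    have "?c 1 P = norm (Q4_Re P)"
      using Q4_norm(1) [OF P] by (metis mult_1 norm_ge_zero one_power2 real_sqrt_unique)
    then show "h (1, P) = id P"
      using Q4_Re_nonzero [OF P] by (simp add: h_def sgn_div_norm Q4_Complex_Re_Im)
    show "h (s, P) \<in> Q4_points" for s
      using Q4_norm [OF P] Q4_Re_nonzero [OF P]
      by (simp add: h_def Q4_Complex_in_Q4_iff norm_sgn power_mult_distrib) (simp add: sgn_div_norm)
  qed
qed


section \<open>The homotopy to the suspension of the Hopf map\<close>

lemma continuous_on_path_entries [continuous_intros]:
  fixes g :: "'b::topological_space \<Rightarrow> 'a::{comm_ring_1,real_normed_algebra}"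
  assumes "continuous_on S g"
  shows "continuous_on S (\<lambda>x. n11 (g x))" "continuous_on S (\<lambda>x. n12 (g x))"
    "continuous_on S (\<lambda>x. n21 (g x))" "continuous_on S (\<lambda>x. e22 (g x))"
    "continuous_on S (\<lambda>x. f1 (g x))" "continuous_on S (\<lambda>x. f2 (g x))"
  unfolding n11_def n12_def n21_def e22_def f1_def f2_def
  by (intro continuous_intros assms)+

lemma continuous_on_w [continuous_intros]:
  fixes g :: "'b::topological_space \<Rightarrow> complex \<times> complex \<times> complex \<times> complex \<times> complex"
  assumes "continuous_on S g"
  shows "continuous_on S (\<lambda>x. w11 (g x))" "continuous_on S (\<lambda>x. w12 (g x))"
    "continuous_on S (\<lambda>x. w21 (g x))" "continuous_on S (\<lambda>x. w22 (g x))"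
proof -
  have w_eq: "w11 P = (case P of (x1, x2, y1, y2, z) \<Rightarrow>
        e22 z + y2 * (n11 z * x2 + n12 z * y1) + x1 * (n21 z * x2))"
      "w12 P = (case P of (x1, x2, y1, y2, z) \<Rightarrow>
        y2 * (n12 z * y2 - n11 z * x1) - x1 * (n21 z * x1))"
      "w21 P = (case P of (x1, x2, y1, y2, z) \<Rightarrow>
        x2 * (n21 z * x2) - y1 * (n11 z * x2 + n12 z * y1))"
      "w22 P = (case P of (x1, x2, y1, y2, z) \<Rightarrow>
        e22 z - y1 * (n12 z * y2 - n11 z * x1) - x2 * (n21 z * x1))"
    for P :: "complex \<times> complex \<times> complex \<times> complex \<times> complex"
    by (cases P; simp)+
  show "continuous_on S (\<lambda>x. w11 (g x))" "continuous_on S (\<lambda>x. w12 (g x))"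
    "continuous_on S (\<lambda>x. w21 (g x))" "continuous_on S (\<lambda>x. w22 (g x))"
    unfolding w_eq case_prod_unfold by (intro continuous_intros assms)+
qed

text \<open>Only the origin needs care: there division by zero gives the value 0, and the quadratic
  bound makes the quotient tend to 0. Applied to \<open>hopf\<close>, this gives continuity of the
  suspension at the poles.\<close>

lemma continuous_on_scaleR_norm:
  fixes g :: "'a::real_normed_vector \<Rightarrow> 'b::real_normed_vector"
  assumes "continuous_on UNIV g" "\<And>u. norm (g u) \<le> (norm u)\<^sup>2"
  shows "continuous_on UNIV (\<lambda>u. g u /\<^sub>R norm u)"
proof -
  have "isCont (\<lambda>u. g u /\<^sub>R norm u) u" for u
  proof (cases "u = 0")
    case True
    have "norm (g u /\<^sub>R norm u) \<le> norm u" for u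
      using assms(2) [of u] by (cases "u = 0") (simp_all add: field_simps power2_eq_square)
    then have "\<forall>\<^sub>F u in at 0. norm (g u /\<^sub>R norm u) \<le> norm u"
      by (rule always_eventually [OF allI])
    then have "((\<lambda>u. g u /\<^sub>R norm u) \<longlongrightarrow> 0) (at 0)"
      by (rule Lim_null_comparison) (rule tendsto_norm_zero [OF tendsto_ident_at])
    with True show ?thesis
      by (simp add: isCont_def)
  next
    case False
    with assms(1) show ?thesis
      by (intro continuous_intros) (auto simp: continuous_on_eq_continuous_at)
  qed
  then show ?thesis
    by (simp add: continuous_at_imp_continuous_on)
qed

lemma hopf_scaleR: "hopf (c *\<^sub>R w) = c\<^sup>2 *\<^sub>R hopf w"
proof -
  obtain u v where w: "w = (u, v)" by fastforce
  show ?thesis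
    by (simp add: w hopf_def scaleR_conv_of_real norm_mult power_mult_distrib power2_eq_square
      right_diff_distrib mult_ac)
qed

lemma norm_hopf: "norm (hopf w) = (norm w)\<^sup>2"
proof (cases "w = 0")
  case False
  then have "norm (hopf (sgn w)) = 1"
    using hopf_in_sphere [of "sgn w"] by (simp add: norm_sgn)
  moreover have "hopf w = (norm w)\<^sup>2 *\<^sub>R hopf (sgn w)"
    using False by (simp add: sgn_div_norm flip: hopf_scaleR)
  ultimately show ?thesis
    by simp
qed (simp add: hopf_def zero_prod_def)

text \<open>\<open>hopf\<close> is homogeneous of degree 2 for real scalars, so normalizing its
  argument costs a factor \<open>(norm w)^2\<close>.\<close>

lemma suspension_hopf: "suspension hopf (w, t) = (hopf w /\<^sub>R norm w, t)"
  by (cases "w = 0") (simp_all add: suspension_def hopf_scaleR power2_eq_square)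

lemma continuous_on_suspension_hopf [continuous_intros]:
  assumes "continuous_on S g"
  shows "continuous_on S (\<lambda>x. suspension hopf (g x))"
proof -
  have "continuous_on UNIV hopf"
    unfolding hopf_def case_prod_unfold by (intro continuous_intros)
  then have "continuous_on UNIV (\<lambda>w. hopf w /\<^sub>R norm w)"
    by (intro continuous_on_scaleR_norm) (auto simp: norm_hopf)
  from continuous_on_compose2 [OF this continuous_on_fst [OF assms] subset_UNIV]
  have "continuous_on S (\<lambda>x. (hopf (fst (g x)) /\<^sub>R norm (fst (g x)), snd (g x)))"
    by (rule continuous_on_Pair) (rule continuous_on_snd [OF assms])
  moreover have "suspension hopf p = (hopf (fst p) /\<^sub>R norm (fst p), snd p)" for p
    unfolding suspension_hopf [symmetric] by simp
  ultimately show ?thesis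
    by presburger
qed

section \<open>Invertibility along the segment of matrices\<close>

lemma n11_pos: "0 < r \<Longrightarrow> r < 1 \<Longrightarrow> n11 (r :: real) > 0"
proof -
  assume r: "0 < r" "r < 1"
  \<comment> \<open>These bounds make the cubic factor of \<open>n11 r\<close> positive. The sign
    matters because the diagonal entries of \<open>E(r)\<close> differ by
    \<open>r * (1 - r) * n11 r\<close>.\<close>
  have "r ^ 3 \<le> r ^ 2" "r ^ 3 \<le> r ^ 1"
    using r by (intro power_decreasing; simp)+
  then have "4 + 5 * r + 6 * r\<^sup>2 - 9 * r ^ 3 > 0"
    using r unfolding power_one_right by linarith
  with r have "4 * r\<^sup>2 * (1 - r) * (4 + 5 * r + 6 * r\<^sup>2 - 9 * r ^ 3) > 0"
    by simp
  also have "4 * r\<^sup>2 * (1 - r) * (4 + 5 * r + 6 * r\<^sup>2 - 9 * r ^ 3) = n11 r"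
    by (simp add: n11_def algebra_simps eval_nat_numeral)
  finally show ?thesis .
qed

lemma path_entries_of_real:
  "n11 (complex_of_real r) = of_real (n11 r)" "e22 (complex_of_real r) = of_real (e22 r)"
  by (simp_all only: n11_def e22_def of_real_add of_real_diff of_real_mult of_real_power
    of_real_numeral of_real_1)


text \<open>Sorts the mixed term by the entries of \<open>N\<close>, which are kept abstract so that
  their long polynomials are not expanded.\<close>

lemma mixed_det_aux:
  fixes x1 x2 y1 y2 t e n l m d p q :: "'a::comm_ring_1"
  shows "(e + y2 * (n * x2 + l * y1) + x1 * (m * x2)) * (- t - d)
      + (e - y1 * (l * y2 - n * x1) - x2 * (m * x1)) * (- t + d)
      - (y2 * (l * y2 - n * x1) - x1 * (m * x1)) * p - (x2 * (m * x2) - y1 * (n * x2 + l * y1)) * q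
    = - t * (2 * e + (x1 * y1 + x2 * y2) * n) + n * ((x1 * y1 - x2 * y2) * d + x1 * y2 * p + x2 * y1 * q)
      + l * (y1 * y1 * q - y2 * y2 * p - 2 * y1 * y2 * d) + m * (x1 * x1 * p - x2 * x2 * q - 2 * x1 * x2 * d)"
  by (simp add: algebra_simps)

text \<open>The left-hand side is the mixed term of the determinant for \<open>W\<close> and
  \<open>- t I + j adj(M) diag(-1, 1) M\<close>. As it is invariant under conjugation and the second
  matrix becomes diagonal, the off-diagonal entries \<open>n12\<close> and \<open>n21\<close> drop
  out.\<close>

lemma mixed_det:
  fixes x1 x2 y1 y2 z t j :: "'a::comm_ring_1"
  defines "P \<equiv> (x1, x2, y1, y2, z)"
  assumes "d = j * (x1 * y1 - x2 * y2)" "p = j * (2 * (y1 * x2))" "q = j * (2 * (x1 * y2))"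
  shows "w11 P * (- t - d) + w22 P * (- t + d) - w12 P * p - w21 P * q
    = - t * (2 * e22 z + (x1 * y1 + x2 * y2) * n11 z) + n11 z * (j * (x1 * y1 + x2 * y2)\<^sup>2)"
proof -
  have "(x1 * y1 - x2 * y2) * d + x1 * y2 * p + x2 * y1 * q = j * (x1 * y1 + x2 * y2)\<^sup>2"
    unfolding assms power2_eq_square by (simp add: algebra_simps)
  moreover have "y1 * y1 * q - y2 * y2 * p - 2 * y1 * y2 * d = 0"
    unfolding assms by (simp add: algebra_simps)
  moreover have "x1 * x1 * p - x2 * x2 * q - 2 * x1 * x2 * d = 0"
    unfolding assms by (simp add: algebra_simps)
  ultimately show ?thesis
    unfolding P_def w11.simps w12.simps w21.simps w22.simps mixed_det_aux
    by (simp only: mult_zero_right add_0_right mult.assoc)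
qed

abbreviation hopf_z :: "(complex \<times> complex) \<times> real \<Rightarrow> complex" where
  "hopf_z p \<equiv> fst (fst (suspension hopf p))"

abbreviation hopf_h :: "(complex \<times> complex) \<times> real \<Rightarrow> complex" where
  "hopf_h p \<equiv> of_real (snd (fst (suspension hopf p)))"

abbreviation height :: "(complex \<times> complex) \<times> real \<Rightarrow> complex" where
  "height p \<equiv> of_real (snd p)"

text \<open>The entries of \<open>(1 - s) W + s U\<^sup>-\<^sup>1 D U\<close>.\<close>

definition m11 :: "real \<Rightarrow> (complex \<times> complex) \<times> real \<Rightarrow> complex" where
  "m11 s p = of_real (1 - s) * w11 (sphere_to_Q4 p) + of_real s * (- height p + \<i> * hopf_h p)"
definition m12 :: "real \<Rightarrow> (complex \<times> complex) \<times> real \<Rightarrow> complex" where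
  "m12 s p = of_real (1 - s) * w12 (sphere_to_Q4 p) + of_real s * (\<i> * hopf_z p)"
definition m21 :: "real \<Rightarrow> (complex \<times> complex) \<times> real \<Rightarrow> complex" where
  "m21 s p = of_real (1 - s) * w21 (sphere_to_Q4 p) + of_real s * (\<i> * cnj (hopf_z p))"
definition m22 :: "real \<Rightarrow> (complex \<times> complex) \<times> real \<Rightarrow> complex" where
  "m22 s p = of_real (1 - s) * w22 (sphere_to_Q4 p) + of_real s * (- height p - \<i> * hopf_h p)"

lemma det_pencil:
  fixes a b c d e f g h :: "'a::comm_ring_1"
  shows "(l * a + k * e) * (l * d + k * h) - (l * b + k * f) * (l * c + k * g)
    = l\<^sup>2 * (a * d - b * c) + k\<^sup>2 * (e * h - f * g) + l * k * (a * h + d * e - b * g - c * f)"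
  by (simp add: algebra_simps power2_eq_square)

lemma sphere_norm_fst:
  assumes "p \<in> sphere 0 1" shows "(norm (fst p))\<^sup>2 = 1 - (snd p)\<^sup>2"
  using assms by (cases p) (simp add: norm_Pair)

lemma suspension_hopf_in_sphere:
  assumes "p \<in> sphere 0 1"
  shows "suspension hopf p \<in> sphere 0 1"
proof -
  obtain w t where p: "p = (w, t)" by fastforce
  have "norm (hopf w /\<^sub>R norm w) = norm w"
    by (cases "w = 0") (simp_all add: norm_hopf power2_eq_square)
  with assms show ?thesis
    by (simp only: p suspension_hopf norm_Pair mem_sphere_0)
qed

lemma det_hopf_matrix:
  assumes "p \<in> sphere 0 1"
  shows "(- height p + \<i> * hopf_h p) * (- height p - \<i> * hopf_h p)
      - (\<i> * hopf_z p) * (\<i> * cnj (hopf_z p)) = 1"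
proof -
  obtain v h t where p: "suspension hopf p = ((v, h), t)" by (metis surj_pair)
  have t: "snd p = t"
    using p by (cases p) (simp add: suspension_hopf)
  have "(cmod v)\<^sup>2 + h\<^sup>2 + t\<^sup>2 = 1"
    using suspension_hopf_in_sphere [OF assms] by (simp add: p norm_Pair)
  then have "complex_of_real ((cmod v)\<^sup>2) + of_real (h\<^sup>2) + of_real (t\<^sup>2) = 1"
    by (metis of_real_1 of_real_add)
  then have "v * cnj v + (of_real h)\<^sup>2 + (of_real t)\<^sup>2 = 1"
    by (simp only: complex_norm_square of_real_power [of h] of_real_power [of t])
  then show ?thesis
    by (simp add: p t algebra_simps power2_eq_square del: complex_mult_cnj)
qed

text \<open>After conjugation by \<open>U\<close> this is \<open>E11 * D22 + E22 * D11\<close>, with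
  imaginary part \<open>n * (E11 - E22)\<close>, where
  \<open>E11 - E22 = r * (1 - r) * n11 r\<close> and \<open>r * (1 - r) = n^2 / 4\<close>.\<close>

lemma mixed_det_hopf:
  assumes "p \<in> sphere 0 1"
  defines "P \<equiv> sphere_to_Q4 p" and "n \<equiv> norm (fst p)" and "r \<equiv> (1 + snd p) / 2"
  shows "w11 P * (- height p - \<i> * hopf_h p) + w22 P * (- height p + \<i> * hopf_h p)
      - w12 P * (\<i> * cnj (hopf_z p)) - w21 P * (\<i> * hopf_z p)
    = Complex (- snd p * (2 * e22 r + r * (1 - r) * n11 r)) (n11 r * n ^ 3 / 4)"
proof -
  obtain u1 u2 t where p: "p = ((u1, u2), t)" by (metis surj_pair)
  \<comment> \<open>Chosen so that \<open>j\<close> times \<open>det M = n^2 / 4\<close> is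
    \<open>i n\<close>, the off-scalar part of \<open>D\<close>. At the poles division by zero gives
    \<open>j = 0\<close>, and the formula still holds.\<close>
  define j where "j = \<i> * (4 / of_real n)"
  have P: "P = (u1 / 2, u2 / 2, cnj u1 / 2, cnj u2 / 2, of_real r)"
    by (simp add: P_def p sphere_to_Q4_def r_def)
  have S: "suspension hopf p = (hopf (u1, u2) /\<^sub>R n, t)"
    by (simp add: p n_def suspension_hopf)
  have H: "hopf_h p = (u1 * cnj u1 - u2 * cnj u2) / of_real n" "hopf_z p = 2 * u1 * cnj u2 / of_real n"
    unfolding S
    by (simp_all add: hopf_def complex_norm_square scaleR_conv_of_real divide_inverse mult_ac
      del: complex_mult_cnj of_real_power)
  have w: "u1 / 2 * (cnj u1 / 2) + u2 / 2 * (cnj u2 / 2) = of_real (r * (1 - r))"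
    using sphere_to_Q4_in_Q4 [OF assms(1)] by (simp add: P_def [symmetric] P Q4_points_def)
  have r: "r * (1 - r) = n\<^sup>2 / 4"
    using sphere_norm_fst [OF assms(1)] by (simp add: n_def r_def field_simps power2_eq_square)
  have j: "j * (of_real (r * (1 - r)))\<^sup>2 = \<i> * of_real (n ^ 3 / 4)"
    by (cases "n = 0") (simp_all add: r j_def power2_eq_square power3_eq_cube)
  have "w11 P * (- height p - \<i> * hopf_h p) + w22 P * (- height p + \<i> * hopf_h p)
      - w12 P * (\<i> * cnj (hopf_z p)) - w21 P * (\<i> * hopf_z p)
    = - height p * (2 * e22 (of_real r) + (u1 / 2 * (cnj u1 / 2) + u2 / 2 * (cnj u2 / 2)) * n11 (of_real r))
      + n11 (of_real r) * (j * (u1 / 2 * (cnj u1 / 2) + u2 / 2 * (cnj u2 / 2))\<^sup>2)"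
    unfolding P
    by (intro mixed_det) (simp_all add: H j_def)
  also have "\<dots> = Complex (- snd p * (2 * e22 r + r * (1 - r) * n11 r)) (n11 r * n ^ 3 / 4)"
    unfolding w j path_entries_of_real by (simp add: p complex_eq_iff)
  finally show ?thesis .
qed

text \<open>As both end matrices have determinant 1, the determinant is
  \<open>(1 - s)^2 + s^2\<close> plus \<open>(1 - s) * s\<close> times the mixed term. The mixed
  term is 2 at the poles and has positive imaginary part elsewhere; at the ends of the segment its
  coefficient vanishes.\<close>

lemma det_m_nonzero:
  assumes "p \<in> sphere 0 1" "s \<in> {0..1}"
  shows "m11 s p * m22 s p - m12 s p * m21 s p \<noteq> 0"
proof -
  define n where "n = norm (fst p)"
  define r where "r = (1 + snd p) / 2"
  define X where "X = - snd p * (2 * e22 r + r * (1 - r) * n11 r)"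
  have det: "m11 s p * m22 s p - m12 s p * m21 s p
      = of_real ((1 - s)\<^sup>2 + s\<^sup>2) + of_real ((1 - s) * s) * Complex X (n11 r * n ^ 3 / 4)"
    unfolding m11_def m12_def m21_def m22_def det_pencil det_hopf_matrix [OF assms(1)]
      det_w [OF sphere_to_Q4_in_Q4 [OF assms(1)]] mixed_det_hopf [OF assms(1)]
      X_def n_def r_def
    by simp
  have pos: "(1 - s)\<^sup>2 + s\<^sup>2 > 0"
    by (cases "s = 0") (auto intro: add_nonneg_pos)
  consider "n = 0" | "s = 0 \<or> s = 1" | "n > 0" "0 < s" "s < 1"
    using assms(2) by (fastforce simp: n_def)
  then show ?thesis
  proof cases
    case 1
    then have "(snd p)\<^sup>2 = 1"
      using sphere_norm_fst [OF assms(1)] by (simp add: n_def)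
    then have "snd p = 1 \<or> snd p = - 1"
      by (simp add: power2_eq_1_iff)
    then have "X = 2"
      by (auto simp: X_def r_def e22_def)
    then have "Re (m11 s p * m22 s p - m12 s p * m21 s p) = (1 - s)\<^sup>2 + s\<^sup>2 + 2 * ((1 - s) * s)"
      unfolding det by simp
    moreover have "(1 - s) * s \<ge> 0"
      using assms(2) by simp
    ultimately show ?thesis
      using pos by (metis add_pos_nonneg less_irrefl mult_nonneg_nonneg zero_complex.sel(1) zero_le_numeral)
  next
    case 2
    with pos show ?thesis
      unfolding det by (auto simp: complex_eq_iff)
  next
    case 3
    then have "(snd p)\<^sup>2 < 1"
      using sphere_norm_fst [OF assms(1)] unfolding n_def by (metis diff_gt_0_iff_gt zero_less_power)
    then have "\<bar>snd p\<bar> < 1"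
      by (simp add: abs_square_less_1)
    then have "n11 r > 0"
      by (intro n11_pos) (auto simp: r_def)
    with 3 have "Im (m11 s p * m22 s p - m12 s p * m21 s p) > 0"
      unfolding det by simp
    then show ?thesis
      by (metis less_irrefl zero_complex.sel(2))
  qed
qed

section \<open>The homotopy through nonvanishing rows\<close>

lemma row_mult_nonzero:
  fixes x :: "'a::idom"
  assumes "(x, y) \<noteq> (0, 0)" "a * d - b * c \<noteq> 0"
  shows "(x * a + y * c, x * b + y * d) \<noteq> (0, 0)"
proof
  assume eq: "(x * a + y * c, x * b + y * d) = (0, 0)"
  have "x * (a * d - b * c) = (x * a + y * c) * d - (x * b + y * d) * c"
    "y * (a * d - b * c) = (x * b + y * d) * a - (x * a + y * c) * b"
    by (simp_all add: algebra_simps)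
  with eq have "x * (a * d - b * c) = 0" "y * (a * d - b * c) = 0"
    by simp_all
  with assms show False by simp
qed

text \<open>The row is finally multiplied by the path \<open>[[1 - s, -i s], [-i s, 1 - s]]\<close> of invertible matrices,
  which ends at the coordinate change needed by \<^const>\<open>Q3_to_sphere\<close>.\<close>

definition homotopy_row :: "real \<times> (complex \<times> complex) \<times> real \<Rightarrow> complex \<times> complex" where
  "homotopy_row = (\<lambda>(s, p).
     let z = of_real ((1 - s) * ((1 + snd p) / 2));
       r1 = f1 z * m11 s p + f2 z * m21 s p; r2 = f1 z * m12 s p + f2 z * m22 s p
     in (r1 * of_real (1 - s) + r2 * (- \<i> * of_real s), r1 * (- \<i> * of_real s) + r2 * of_real (1 - s)))"

lemma continuous_on_homotopy_row: "continuous_on S homotopy_row"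
  unfolding homotopy_row_def m11_def m12_def m21_def m22_def case_prod_unfold Let_def sphere_to_Q4_def
  by (intro continuous_intros) auto

lemma homotopy_row_nonzero:
  assumes "p \<in> sphere 0 1" "s \<in> {0..1}"
  shows "homotopy_row (s, p) \<noteq> (0, 0)"
proof -
  have f: "(f1 z, f2 z) \<noteq> (0, 0)" for z :: complex
    using f_unimodular [of z] by auto
  have "(1 - s)\<^sup>2 + s\<^sup>2 > 0"
    by (cases "s = 0") (auto intro: add_nonneg_pos)
  then have "complex_of_real ((1 - s)\<^sup>2 + s\<^sup>2) \<noteq> 0"
    by (metis less_irrefl of_real_eq_0_iff)
  \<comment> \<open>The off-diagonal product is \<open>(- i s)^2 = - s^2\<close>, so this
    determinant is the positive number \<open>(1 - s)^2 + s^2\<close>.\<close>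
  then have A: "complex_of_real (1 - s) * of_real (1 - s) - (- \<i> * of_real s) * (- \<i> * of_real s) \<noteq> 0"
    by (simp add: power2_eq_square algebra_simps)
  show ?thesis
    unfolding homotopy_row_def case_prod_conv Let_def
    by (intro row_mult_nonzero [OF _ A] row_mult_nonzero [OF f] det_m_nonzero assms)
qed

lemma Q3_to_sphere_cong: "Q3_to_sphere (a, b, c, d) = Q3_to_sphere (a, b, c', d')"
  by (simp add: Q3_to_sphere_def)

text \<open>The conjugates only fill the last two slots, which \<open>Q3_to_sphere\<close> does not
  read; this extends it to arbitrary nonzero rows.\<close>

definition normalize_row :: "complex \<times> complex \<Rightarrow> (complex \<times> real) \<times> real" where
  "normalize_row = (\<lambda>(a, b). Q3_to_sphere (a, b, cnj a, cnj b))"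

lemma normalize_row_in_sphere:
  assumes "w \<noteq> (0, 0)"
  shows "normalize_row w \<in> sphere 0 1"
proof -
  obtain a b where w: "w = (a, b)" by fastforce
  \<comment> \<open>A nonzero row over a field is unimodular, so it lifts to a point of the quadric,
    where \<open>Q3_to_sphere\<close> is known to land in the sphere.\<close>
  have "\<exists>c d. (a, b, c, d) \<in> Q3_points"
  proof (cases "a = 0")
    case True
    with assms have "(a, b, 0, 1 / b) \<in> Q3_points" by (simp add: w Q3_points_def)
    then show ?thesis by blast
  next
    case False
    then have "(a, b, 1 / a, 0) \<in> Q3_points" by (simp add: Q3_points_def)
    then show ?thesis by blast
  qed
  then show ?thesis
    unfolding w normalize_row_def case_prod_conv by (metis Q3_to_sphere_cong Q3_to_sphere_in_sphere)
qed

lemma continuous_on_normalize_row: "continuous_on (- {(0, 0)}) normalize_row"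
  unfolding normalize_row_def Q3_to_sphere_def case_prod_unfold
  by (intro continuous_intros) (auto simp: zero_prod_def)

lemma normalize_row_unit:
  assumes "(cmod v)\<^sup>2 + h\<^sup>2 + t\<^sup>2 = 1"
  shows "normalize_row (v, Complex h t) = ((v, h), t)"
proof -
  have "norm (v, Complex h t) = 1"
    using assms by (simp add: norm_Pair cmod_power2)
  then show ?thesis
    by (simp add: normalize_row_def Q3_to_sphere_def)
qed

lemma homotopy_row_0:
  assumes "p \<in> sphere 0 1"
  shows "homotopy_row (0, p) =
    (value_at (sphere_to_Q4 p) (to_zq4 a'), value_at (sphere_to_Q4 p) (to_zq4 b'))"
proof -
  note Q4 = sphere_to_Q4_in_Q4 [OF assms]
  obtain u1 u2 t where p: "p = ((u1, u2), t)" by (metis surj_pair)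
  have P: "sphere_to_Q4 p = (u1 / 2, u2 / 2, cnj u1 / 2, cnj u2 / 2, of_real ((1 + snd p) / 2))"
    by (simp add: p sphere_to_Q4_def)
  show ?thesis
    using Q4 unfolding P
    by (simp add: homotopy_row_def m11_def m12_def m21_def m22_def P value_at_to_zq4 eval_a' eval_b' Let_def
      del: coords.simps w11.simps w12.simps w21.simps w22.simps)
qed

lemma normalize_homotopy_row_1:
  assumes "p \<in> sphere 0 1"
  shows "normalize_row (homotopy_row (1, p)) = suspension hopf p"
proof -
  obtain v h t where p: "suspension hopf p = ((v, h), t)" by (metis surj_pair)
  have t: "snd p = t"
    using p by (cases p) (simp add: suspension_hopf)
  have "(cmod v)\<^sup>2 + h\<^sup>2 + t\<^sup>2 = 1"
    using suspension_hopf_in_sphere [OF assms] by (simp add: p norm_Pair)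
  \<comment> \<open>At \<open>s = 1\<close> the row \<open>(f1, f2)\<close> is
    \<open>(1, 0)\<close>, which picks out \<open>(- t + i h, i v)\<close>; swapping the entries and
    multiplying by \<open>- i\<close> gives \<open>(v, h + i t)\<close>.\<close>
  moreover have "homotopy_row (1, p) = (v, Complex h t)"
    by (simp add: homotopy_row_def m11_def m12_def m21_def m22_def f1_def f2_def p t complex_eq_iff)
  ultimately show ?thesis
    by (simp add: normalize_row_unit p)
qed

lemma realization_homotopic_suspension_hopf:
  "homotopic_with_canon (\<lambda>_. True) (sphere 0 1) (sphere 0 1)
     (Q3_to_sphere \<circ> realization (to_zq4 a', to_zq4 b', g1, g2) \<circ> sphere_to_Q4) (suspension hopf)"
proof (rule homotopic_with_canonI)
  show "continuous_on ({0..1} \<times> sphere 0 1) (normalize_row \<circ> homotopy_row)"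
  proof (intro continuous_on_compose continuous_on_homotopy_row
      continuous_on_subset [OF continuous_on_normalize_row])
    show "homotopy_row ` ({0..1} \<times> sphere 0 1) \<subseteq> - {(0, 0)}"
    proof (rule image_subsetI)
      fix w :: "real \<times> (complex \<times> complex) \<times> real"
      assume "w \<in> {0..1} \<times> sphere 0 1"
      then show "homotopy_row w \<in> - {(0, 0)}"
        using homotopy_row_nonzero [of "snd w" "fst w"] by (simp add: mem_Times_iff)
    qed
  qed
  show "(normalize_row \<circ> homotopy_row) (s, p) \<in> sphere 0 1" if "s \<in> {0..1}" "p \<in> sphere 0 1" for s p
    using normalize_row_in_sphere [OF homotopy_row_nonzero] that by simp
  show "(normalize_row \<circ> homotopy_row) (0, p)
      = (Q3_to_sphere \<circ> realization (to_zq4 a', to_zq4 b', g1, g2) \<circ> sphere_to_Q4) p"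
    if "p \<in> sphere 0 1" for p
    using that by (simp add: homotopy_row_0 normalize_row_def Q3_to_sphere_def)
  show "(normalize_row \<circ> homotopy_row) (1, p) = suspension hopf p" if "p \<in> sphere 0 1" for p
    using that by (simp add: normalize_homotopy_row_1)
qed

theorem theorem2:
  shows "unimodular_row (to_zq4 a') (to_zq4 b') \<and>
    homotopy_equivalence (sphere 0 1) Q4_points sphere_to_Q4 \<and>
    homotopy_equivalence Q3_points (sphere 0 1) Q3_to_sphere \<and>
    (\<forall>g1 g2. (to_zq4 a', to_zq4 b', g1, g2) \<in> Q3_points \<longrightarrow>
       homotopic_with_canon (\<lambda>_. True) (sphere 0 1) (sphere 0 1)
         (Q3_to_sphere \<circ> realization (to_zq4 a', to_zq4 b', g1, g2) \<circ> sphere_to_Q4)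
         (suspension hopf))"
  using unimodular_a'_b' homotopy_equivalence_Q4 homotopy_equivalence_Q3
    realization_homotopic_suspension_hopf
  by blast

end
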